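(* (Reverse polynomial.) Let $B_1,\dots,B_n\in\mathbb{C}^{p\times m}$, let $q$ be an integer and let $F(z)=z^{q}\left(z^{-1}B_1+\cdots+z^{-n}B_n\right)$. If $F$ is in $\mathcal{U}$, then so is $$F_{\rm rev}(z):=z^{-1}B_n+z^{-2}B_{n-1}+\cdots+z^{1-n}B_2+z^{-n}B_1.$$
   Context: With $\mathbb{T}=\{z\in\mathbb{C}:|z|=1\}$, the class $\mathcal{U}$ consists of the $p\times m$-valued rational functions with $F(z)^*F(z)=I_m$ for all $z\in\mathbb{T}$ if $p\ge m$ (isometry), and $F(z)F(z)^*=I_p$ for all $z\in\mathbb{T}$ if $m\ge p$ (co-isometry). *)

theory Defs
  imports "HOL-Analysis.Analysis" "HOL-Computational_Algebra.Polynomial"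
begin

definition conj_transpose :: "complex ^ 'm ^ 'p \<Rightarrow> complex ^ 'p ^ 'm" where
  "conj_transpose A = (\<chi> i j. cnj (A $ j $ i))"

definition mat_scale :: "complex \<Rightarrow> complex ^ 'm ^ 'p \<Rightarrow> complex ^ 'm ^ 'p"  (infixr "*\<^sub>m" 75) where
  "c *\<^sub>m A = (\<chi> i j. c * A $ i $ j)"

text \<open>A matrix-valued rational function is represented by a total function whose entries agree
  with a quotient of polynomials wherever the denominator does not vanish; the values at the
  (finitely many) zeros of the denominators are irrelevant.  Membership in the class below asks
  for values on the whole unit circle, so the denominators are required not to vanish there.\<close>

definition rational_regular_on :: "complex set \<Rightarrow> (complex \<Rightarrow> complex ^ 'm ^ 'p) \<Rightarrow> bool" where
  "rational_regular_on S F \<longleftrightarrow>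
     (\<forall>i j. \<exists>P Q :: complex poly. Q \<noteq> 0 \<and> (\<forall>z\<in>S. poly Q z \<noteq> 0) \<and>
        (\<forall>z. poly Q z \<noteq> 0 \<longrightarrow> F z $ i $ j = poly P z / poly Q z))"

definition class_U :: "(complex \<Rightarrow> complex ^ 'm ^ 'p) set" where
  "class_U = {F. rational_regular_on (sphere 0 1) F \<and>
     (CARD('p) \<ge> CARD('m) \<longrightarrow> (\<forall>z\<in>sphere 0 1. conj_transpose (F z) ** F z = mat 1)) \<and>
     (CARD('m) \<ge> CARD('p) \<longrightarrow> (\<forall>z\<in>sphere 0 1. F z ** conj_transpose (F z) = mat 1))}"

end

theory Submission
  imports Defs
begin

text \<open>
  Write \<open>F\<close> for the given function and \<open>R\<close> for its reversal.  Re-indexing the sum by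
  \<open>k \<mapsto> n + 1 - k\<close> gives \<open>R z = z powi (q - (n + 1)) *\<^sub>m F (1/z)\<close> for all \<open>z \<noteq> 0\<close>
  (\<open>reverse_eq_scaled_inverse\<close>).  On the unit circle the scalar factor is unimodular and
  \<open>1/z\<close> lies on the circle again, so the isometry (co-isometry) identity for \<open>F\<close> at \<open>1/z\<close>
  is the one for \<open>R\<close> at \<open>z\<close>.  The function \<open>R\<close> is rational with denominator \<open>z ^ n\<close>, which
  has no zero on the circle (\<open>rational_regular_on_laurent_sum\<close>).
\<close>

lemma mat_scale_nth [simp]: "(c *\<^sub>m A) $ i $ j = c * A $ i $ j"
  by (simp add: mat_scale_def)

lemma mat_scale_sum: "c *\<^sub>m (\<Sum>k\<in>S. A k) = (\<Sum>k\<in>S. c *\<^sub>m A k)"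
  by (simp add: vec_eq_iff sum_distrib_left)

lemma mat_scale_mat_scale: "c *\<^sub>m d *\<^sub>m A = (c * d) *\<^sub>m A"
  by (simp add: vec_eq_iff mult.assoc)

lemma isometry_mat_scale:
  assumes "norm c = 1"
  shows "conj_transpose (c *\<^sub>m A) ** (c *\<^sub>m A) = conj_transpose A ** A"
    and "(c *\<^sub>m A) ** conj_transpose (c *\<^sub>m A) = A ** conj_transpose A"
proof -
  have c: "cnj c * c = 1"
    using assms complex_norm_square[of c] by (simp add: mult.commute)
  have 1: "cnj (c * a) * (c * b) = cnj a * b" for a b
  proof -
    have "cnj (c * a) * (c * b) = (cnj c * c) * (cnj a * b)"
      by (simp only: complex_cnj_mult ac_simps)
    then show ?thesis
      by (simp only: c mult_1_left)
  qed
  have 2: "(c * b) * cnj (c * a) = b * cnj a" for a b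
    using 1[of a b] by (simp only: mult.commute)
  show "conj_transpose (c *\<^sub>m A) ** (c *\<^sub>m A) = conj_transpose A ** A"
    and "(c *\<^sub>m A) ** conj_transpose (c *\<^sub>m A) = A ** conj_transpose A"
    by (simp_all only: matrix_matrix_mult_def conj_transpose_def vec_lambda_beta mat_scale_nth 1 2)
qed

lemma rational_regular_on_laurent_sum:
  fixes C :: "nat \<Rightarrow> complex ^ 'm ^ 'p"
  assumes "0 \<notin> S"
  shows "rational_regular_on S (\<lambda>z. \<Sum>k=1..n. (z powi (- int k)) *\<^sub>m C k)"
  unfolding rational_regular_on_def
proof (intro allI)
  fix i j
  let ?Q = "monom 1 n :: complex poly"
  let ?P = "\<Sum>k=1..n. monom (C k $ i $ j) (n - k)"
  have "\<forall>z\<in>S. poly ?Q z \<noteq> 0"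
    using assms by (auto simp: poly_monom)
  moreover have "\<forall>z. poly ?Q z \<noteq> 0 \<longrightarrow>
      (\<Sum>k=1..n. (z powi (- int k)) *\<^sub>m C k) $ i $ j = poly ?P z / poly ?Q z"
  proof (intro allI impI)
    fix z :: complex
    assume Q: "poly ?Q z \<noteq> 0"
    \<comment> \<open>For \<open>n = 0\<close> the denominator is \<open>1\<close> and \<open>z\<close> may be \<open>0\<close>, but then the sum is empty.\<close>
    have "z powi (- int k) * C k $ i $ j = C k $ i $ j * z ^ (n - k) / z ^ n"
      if k: "k \<in> {1..n}" for k
    proof -
      have "z \<noteq> 0"
        using Q k by (auto simp: poly_monom)
      then show ?thesis
        using k by (simp add: power_int_minus power_diff field_simps)
    qed
    then show "(\<Sum>k=1..n. (z powi (- int k)) *\<^sub>m C k) $ i $ j = poly ?P z / poly ?Q z"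
      by (simp add: poly_sum poly_monom sum_divide_distrib)
  qed
  ultimately show "\<exists>P Q. Q \<noteq> 0 \<and> (\<forall>z\<in>S. poly Q z \<noteq> 0) \<and> (\<forall>z. poly Q z \<noteq> 0 \<longrightarrow>
      (\<Sum>k=1..n. (z powi (- int k)) *\<^sub>m C k) $ i $ j = poly P z / poly Q z)"
    by (intro exI[of _ ?P] exI[of _ ?Q]) simp
qed

lemma reverse_eq_scaled_inverse:
  fixes B :: "nat \<Rightarrow> complex ^ 'm ^ 'p" and n :: nat and q :: int
  assumes "z \<noteq> 0"
  shows "(\<Sum>k=1..n. (z powi (- int k)) *\<^sub>m B (n + 1 - k)) =
    (z powi (q - int (n + 1))) *\<^sub>m
      (inverse z powi q) *\<^sub>m (\<Sum>k=1..n. (inverse z powi (- int k)) *\<^sub>m B k)"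
proof -
  have "(\<Sum>k=1..n. (z powi (- int k)) *\<^sub>m B (n + 1 - k)) =
      (\<Sum>k=1..n. (z powi (int k - int (n + 1))) *\<^sub>m B k)"
    by (subst sum.atLeastAtMost_rev) (auto intro!: sum.cong simp: of_nat_diff)
  also have "\<dots> = (\<Sum>k=1..n. (z powi (q - int (n + 1))) *\<^sub>m
      (inverse z powi q) *\<^sub>m (inverse z powi (- int k)) *\<^sub>m B k)"
  proof (rule sum.cong)
    fix k
    have "z powi (int k - int (n + 1)) =
        z powi (q - int (n + 1)) * (inverse z powi q * inverse z powi (- int k))"
      using assms by (simp add: power_int_inverse power_int_minus power_int_diff field_simps)
    then show "(z powi (int k - int (n + 1))) *\<^sub>m B k = (z powi (q - int (n + 1))) *\<^sub>m
        (inverse z powi q) *\<^sub>m (inverse z powi (- int k)) *\<^sub>m B k"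
      by (simp only: mat_scale_mat_scale)
  qed simp
  finally show ?thesis
    by (simp only: mat_scale_sum)
qed

theorem mainTheorem5:
  fixes B :: "nat \<Rightarrow> complex ^ 'm ^ 'p" and n :: nat and q :: int
  assumes "(\<lambda>z. (z powi q) *\<^sub>m (\<Sum>k=1..n. (z powi (- int k)) *\<^sub>m B k)) \<in> class_U"
  shows "(\<lambda>z. \<Sum>k=1..n. (z powi (- int k)) *\<^sub>m B (n + 1 - k)) \<in> class_U"
proof -
  define F where "F = (\<lambda>z. (z powi q) *\<^sub>m (\<Sum>k=1..n. (z powi (- int k)) *\<^sub>m B k))"
  define R where "R = (\<lambda>z. \<Sum>k=1..n. (z powi (- int k)) *\<^sub>m B (n + 1 - k))"
  have F: "F \<in> class_U"
    using assms by (simp only: F_def)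
  have "rational_regular_on (sphere 0 1) R"
    unfolding R_def by (rule rational_regular_on_laurent_sum) simp
  moreover have "conj_transpose (R z) ** R z = conj_transpose (F (inverse z)) ** F (inverse z)"
      "R z ** conj_transpose (R z) = F (inverse z) ** conj_transpose (F (inverse z))"
      "inverse z \<in> sphere 0 1" if z: "z \<in> sphere 0 1" for z
  proof -
    have "z \<noteq> 0"
      using z by auto
    then have R: "R z = (z powi (q - int (n + 1))) *\<^sub>m F (inverse z)"
      unfolding R_def F_def by (rule reverse_eq_scaled_inverse)
    have c: "norm (z powi (q - int (n + 1))) = 1"
      using z by (simp add: norm_power_int)
    show "conj_transpose (R z) ** R z = conj_transpose (F (inverse z)) ** F (inverse z)"
      and "R z ** conj_transpose (R z) = F (inverse z) ** conj_transpose (F (inverse z))"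
      unfolding R by (rule isometry_mat_scale[OF c])+
    show "inverse z \<in> sphere 0 1"
      using z by (simp add: norm_inverse)
  qed
  ultimately have "R \<in> class_U"
    using F by (simp add: class_U_def)
  then show ?thesis
    by (simp only: R_def)
qed

end
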